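(* Let $\mu_*$ be a probability measure on $\mathbb R^d$ supported on a compact set $K_*$, let $D:=1+\max_{x\in K_*}\|x\|_\infty$, and let $q_t$ be as in the context. For any integer $p\ge3$, any $y\in\mathbb R^d$ and any $t>0$, $$\|\nabla^p\log q_t(y)\|_\infty\le(4\,p!)\,\frac{\lambda_t^pD^p}{\sigma_t^{2p}} .$$ Also, for any $i,j\in\{1,\dots,d\}$, $y\in\mathbb R^d$ and $t>0$, $$|\partial_{y_i}\log q_t(y)|\le\frac{|y_i|+\lambda_tD}{\sigma_t^2},\qquad |\partial^2_{y_iy_j}\log q_t(y)|\le\frac{\delta_{ij}}{\sigma_t^2}+2\,\frac{\lambda_t^2D^2}{\sigma_t^4} .$$
   Context: $\lambda_t=e^{-t}$, $\sigma_t=\sqrt{1-e^{-2t}}$, and for $t>0$ $$q_t(y)=\int_{\mathbb R^d}\frac1{(\sqrt{2\pi}\,\sigma_t)^d}\,e^{-\|y-\lambda_tx\|_2^2/(2\sigma_t^2)}\,d\mu_*(x),$$ i.e. the density of $\lambda_tX_0+\sigma_tW$ with $X_0\sim\mu_*$ and $W\sim\mathcal N(0,\mathbb I_d)$ independent. $\|\nabla^pf(y)\|_\infty$ is the maximum absolute value of the entries of the tensor of $p$-th order partial derivatives; $\delta_{ij}$ is the Kronecker delta. *)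

theory Defs
  imports "HOL-Probability.Probability"
begin

definition lam :: "real \<Rightarrow> real" where
  "lam t = exp (- t)"

definition sig :: "real \<Rightarrow> real" where
  "sig t = sqrt (1 - exp (- 2 * t))"

definition q_density :: "(real ^ 'n) measure \<Rightarrow> real \<Rightarrow> real ^ 'n \<Rightarrow> real" where
  "q_density \<mu> t y =
     (\<integral>x. 1 / (sqrt (2 * pi) * sig t) ^ CARD('n)
            * exp (- (norm (y - lam t *\<^sub>R x))\<^sup>2 / (2 * (sig t)\<^sup>2)) \<partial>\<mu>)"

text \<open>
  The iterated partial derivative for the index list \<open>[i\<^sub>1, \<dots>, i\<^sub>p]\<close> takes the derivative in
  direction \<open>i\<^sub>p\<close> first and the one in direction \<open>i\<^sub>1\<close> last.  Since \<^const>\<open>deriv\<close> is total,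
  its value is meaningful only together with \<open>partials_exist\<close>, which says that every partial
  derivative taken along the way exists at every point.
\<close>

primrec partials :: "'n list \<Rightarrow> (real ^ 'n \<Rightarrow> real) \<Rightarrow> real ^ 'n \<Rightarrow> real" where
  "partials [] f = f"
| "partials (i # is) f = (\<lambda>y. deriv (\<lambda>h. partials is f (y + h *\<^sub>R axis i 1)) 0)"

primrec partials_exist :: "'n list \<Rightarrow> (real ^ 'n \<Rightarrow> real) \<Rightarrow> bool" where
  "partials_exist [] f \<longleftrightarrow> True"
| "partials_exist (i # is) f \<longleftrightarrow> partials_exist is f \<and>
     (\<forall>y. (\<lambda>h. partials is f (y + h *\<^sub>R axis i 1)) field_differentiable (at 0))"

text \<open>The maximum is over a finite nonempty set: there are \<open>CARD('n) ^ p\<close> index lists.\<close>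

definition deriv_tensor_norm :: "nat \<Rightarrow> (real ^ 'n \<Rightarrow> real) \<Rightarrow> real ^ 'n \<Rightarrow> real" where
  "deriv_tensor_norm p f y = Max ((\<lambda>is. \<bar>partials is f y\<bar>) ` {is :: 'n list. length is = p})"

end

theory Submission
  imports Defs
begin

text \<open>
  Fix \<open>t\<close> and a point \<open>z\<close>, and write \<open>\<lambda>\<close>, \<open>\<sigma>\<close> for \<open>lam t\<close>, \<open>sig t\<close>.  Expanding the square in the
  Gaussian, \<open>ln (q y)\<close> is a quadratic polynomial in \<open>y\<close> plus \<open>ln (E (exp (X \<bullet> (y - z))))\<close>.  Here
  the mean is taken under the posterior law of \<open>x\<close> given \<open>z\<close>, and \<open>X = (\<lambda> / \<sigma>^2) (x - E x)\<close> is
  centered.  So for orders at least 3 the partial derivatives of \<open>ln q\<close> at \<open>z\<close> are the joint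
  cumulants of the components of \<open>X\<close>.

  Let \<open>f\<close> be the moment generating function of \<open>X\<close>.  Applying the Leibniz rule to
  \<open>\<partial>\<^sub>i f = (\<partial>\<^sub>i (ln f)) f\<close> expresses a cumulant by lower ones and by moments.  If \<open>a k * B^k\<close>
  bounds the centered moments of order \<open>k\<close>, where \<open>B = \<lambda> D / \<sigma>^2\<close>, induction gives the bound
  \<open>p! B^p\<close> as soon as the sum of \<open>a k / k!\<close> over \<open>k \<ge> 2\<close> is at most 1.  Bounding all but two
  factors by \<open>2 B\<close> gives \<open>a k = 2^(k - 2)\<close>, for which the sum is about 1.097, slightly too large.
  But a component of mean \<open>b\<close> has variance at most \<open>B^2 - b^2\<close> and deviates from \<open>b\<close> by at most
  \<open>B + \<bar>b\<bar>\<close>, which improves \<open>a 3\<close> to \<open>32 / 27 < 4 / 3\<close> and brings the sum below 1.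
\<close>

section \<open>Iterated partial derivatives\<close>

definition all_partials_exist :: "(real ^ 'n \<Rightarrow> real) \<Rightarrow> bool" where
  "all_partials_exist f \<longleftrightarrow> (\<forall>is. partials_exist is f)"

text \<open>Carries existence along with the value, which an equation about the total function
  \<open>deriv\<close> does not.\<close>

definition has_partial :: "'n \<Rightarrow> (real ^ 'n \<Rightarrow> real) \<Rightarrow> (real ^ 'n \<Rightarrow> real) \<Rightarrow> bool" where
  "has_partial i f g \<longleftrightarrow>
     (\<forall>y. ((\<lambda>h. f (y + h *\<^sub>R axis i 1)) has_real_derivative g y) (at 0))"

lemma partials_singleton_eq:
  assumes "has_partial i f g"
  shows "partials [i] f = g"
  using assms by (auto simp: has_partial_def fun_eq_iff intro: DERIV_imp_deriv)

lemma partials_append: "partials (is @ js) f = partials is (partials js f)"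
  by (induction "is") auto

lemma all_partials_exist_iff:
  "all_partials_exist f \<longleftrightarrow> (\<forall>is i. has_partial i (partials is f) (partials (i # is) f))"
proof
  show "\<forall>is i. has_partial i (partials is f) (partials (i # is) f)" if "all_partials_exist f"
  proof (intro allI)
    fix i "is"
    from that have "partials_exist (i # is) f"
      unfolding all_partials_exist_def by blast
    then show "has_partial i (partials is f) (partials (i # is) f)"
      by (simp add: has_partial_def field_differentiable_derivI)
  qed
  assume *: "\<forall>is i. has_partial i (partials is f) (partials (i # is) f)"
  have "partials_exist is f" for "is"
    using * by (induction "is") (auto simp: has_partial_def field_differentiable_def)
  then show "all_partials_exist f"
    by (simp add: all_partials_exist_def)
qed

lemma has_partial_partials:
  "all_partials_exist f \<Longrightarrow> has_partial i (partials is f) (partials (i # is) f)"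
  by (simp add: all_partials_exist_iff del: partials.simps)

lemma all_partials_exist_partials:
  "all_partials_exist f \<Longrightarrow> all_partials_exist (partials is f)"
  by (simp add: all_partials_exist_iff del: partials.simps flip: partials_append)

text \<open>A table of candidate derivatives indexed by lists is certified by checking one
  differentiation step; induction on the list does the rest. Exponential moments, Leibniz sums,
  translates and quadratics all enter this way.\<close>

lemma partials_family:
  assumes "\<And>is i. has_partial i (F is) (F (i # is))"
  shows "partials is (F []) = F is" "all_partials_exist (F [])"
proof -
  have *: "partials is (F []) = F is" for "is"
  proof (induction "is")
    case (Cons i "is")
    then show ?case
      using partials_singleton_eq[OF assms[of i "is"]] by simp
  qed simp
  then show "partials is (F []) = F is" .
  show "all_partials_exist (F [])"
    unfolding all_partials_exist_iff * using assms by blast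
qed

lemma has_partial_add:
  "has_partial i f f' \<Longrightarrow> has_partial i g g' \<Longrightarrow>
    has_partial i (\<lambda>y. f y + g y) (\<lambda>y. f' y + g' y)"
  by (auto simp: has_partial_def intro: DERIV_add)

lemma has_partial_mult:
  assumes "has_partial i f f'" "has_partial i g g'"
  shows "has_partial i (\<lambda>y. f y * g y) (\<lambda>y. f' y * g y + f y * g' y)"
  unfolding has_partial_def
proof
  fix y
  from assms show "((\<lambda>h. f (y + h *\<^sub>R axis i 1) * g (y + h *\<^sub>R axis i 1))
      has_real_derivative f' y * g y + f y * g' y) (at 0)"
    unfolding has_partial_def by (auto intro!: derivative_eq_intros)
qed

lemma
  assumes "all_partials_exist f" "all_partials_exist g"
  shows partials_add: "partials is (\<lambda>y. f y + g y) = (\<lambda>y. partials is f y + partials is g y)"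
    and all_partials_exist_add: "all_partials_exist (\<lambda>y. f y + g y)"
  using partials_family[of "\<lambda>is y. partials is f y + partials is g y"]
    has_partial_add[OF has_partial_partials[OF assms(1)] has_partial_partials[OF assms(2)]]
  by (simp_all del: partials.simps(2))

section \<open>Partial derivatives of a logarithm\<close>

text \<open>Gives smoothness without explicit formulas: differentiation never leaves
  \<open>S\<close>, so every iterated partial can be differentiated once more.\<close>

lemma all_partials_exist_closed:
  assumes "f \<in> S" and "\<And>f i. f \<in> S \<Longrightarrow> \<exists>g\<in>S. has_partial i f g"
  shows "all_partials_exist f"
proof -
  have in_S: "partials is f \<in> S" for "is"
  proof (induction "is")
    case (Cons i "is")
    then obtain g where "g \<in> S" "has_partial i (partials is f) g"
      using assms(2) by blast
    then show ?case
      using partials_singleton_eq[of i "partials is f" g] by simp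
  qed (simp add: assms(1))
  have "has_partial i (partials is f) (partials (i # is) f)" for i "is"
  proof -
    obtain g where "g \<in> S" "has_partial i (partials is f) g"
      using assms(2) in_S by blast
    then show ?thesis
      using partials_singleton_eq[of i "partials is f" g] by simp
  qed
  then show ?thesis
    by (simp add: all_partials_exist_iff del: partials.simps)
qed

text \<open>A candidate for the closed set above: the derivative of a generator may be any
  polynomial in the generators.\<close>

inductive_set generated_algebra :: "('a \<Rightarrow> real) set \<Rightarrow> ('a \<Rightarrow> real) set"
  for G where
  gen: "f \<in> G \<Longrightarrow> f \<in> generated_algebra G"
| const: "(\<lambda>_. c) \<in> generated_algebra G"
| add: "f \<in> generated_algebra G \<Longrightarrow> g \<in> generated_algebra G \<Longrightarrow>
    (\<lambda>y. f y + g y) \<in> generated_algebra G"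
| mult: "f \<in> generated_algebra G \<Longrightarrow> g \<in> generated_algebra G \<Longrightarrow>
    (\<lambda>y. f y * g y) \<in> generated_algebra G"

lemma generated_algebra_has_partial:
  assumes gens: "\<And>f i. f \<in> G \<Longrightarrow> \<exists>g\<in>generated_algebra G. has_partial i f g"
    and "f \<in> generated_algebra G"
  shows "\<exists>g\<in>generated_algebra G. has_partial i f g"
  using assms(2)
proof induction
  case (gen f)
  then show ?case by (rule gens)
next
  case (const c)
  have "has_partial i (\<lambda>_. c) (\<lambda>_. 0)"
    by (simp add: has_partial_def)
  then show ?case
    using generated_algebra.const by blast
next
  case (add f g)
  then show ?case
    using has_partial_add generated_algebra.add by blast
next
  case (mult f g)
  then obtain f' g' where "f' \<in> generated_algebra G" "has_partial i f f'"
      "g' \<in> generated_algebra G" "has_partial i g g'"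
    by blast
  with mult.hyps show ?case
    by (intro bexI[where x = "\<lambda>y. f' y * g y + f y * g' y"] has_partial_mult
        generated_algebra.add generated_algebra.mult)
qed

text \<open>Every denominator is \<open>g\<close>, so ratios over one fixed function stay closed
  under differentiation up to products and differences.\<close>

lemma has_partial_divide:
  assumes "has_partial i f f'" "has_partial i g g'" "\<And>y. g y \<noteq> 0"
  shows "has_partial i (\<lambda>y. f y / g y) (\<lambda>y. f' y / g y - f y / g y * (g' y / g y))"
  unfolding has_partial_def
proof
  fix y
  from assms show "((\<lambda>h. f (y + h *\<^sub>R axis i 1) / g (y + h *\<^sub>R axis i 1))
      has_real_derivative f' y / g y - f y / g y * (g' y / g y)) (at 0)"
    unfolding has_partial_def
    by (auto intro!: derivative_eq_intros simp: field_simps)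
qed

lemma has_partial_ln:
  assumes "has_partial i f f'" "\<And>y. f y > 0"
  shows "has_partial i (\<lambda>y. ln (f y)) (\<lambda>y. f' y / f y)"
  unfolding has_partial_def
proof
  fix y
  from assms show "((\<lambda>h. ln (f (y + h *\<^sub>R axis i 1))) has_real_derivative f' y / f y) (at 0)"
    unfolding has_partial_def by (auto intro!: derivative_eq_intros)
qed

text \<open>The ratios \<open>partials is f y / f y\<close> generate an algebra closed under
  differentiation, and the first partials of the logarithm are such ratios.\<close>

lemma all_partials_exist_ln:
  fixes f :: "real ^ 'n \<Rightarrow> real"
  assumes f: "all_partials_exist f" and pos: "\<And>y. f y > 0"
  shows "all_partials_exist (\<lambda>y. ln (f y))"
proof -
  define G where "G = range (\<lambda>is y. partials is f y / f y)"
  have ratio: "(\<lambda>y. partials is f y / f y) \<in> generated_algebra G" for "is"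
    by (auto simp: G_def intro: generated_algebra.gen)
  have nz: "f y \<noteq> 0" for y
    using pos[of y] by simp
  have "\<exists>g\<in>generated_algebra G. has_partial i r g" if "r \<in> G" for r i
  proof -
    from that obtain "is" where r: "r = (\<lambda>y. partials is f y / f y)"
      by (auto simp: G_def)
    \<comment> \<open>Subtraction is addition of a multiple by -1; the extra abstractions give the
      term the literal shape of the introduction rules.\<close>
    have "(\<lambda>y. (\<lambda>y. partials (i # is) f y / f y) y
          + (\<lambda>y. (\<lambda>_. -1) y * (\<lambda>y. (\<lambda>y. partials is f y / f y) y * (\<lambda>y. partials [i] f y / f y) y) y) y)
        \<in> generated_algebra G"
      by (intro generated_algebra.add generated_algebra.mult generated_algebra.const ratio)
    moreover have "has_partial i r (\<lambda>y. partials (i # is) f y / f y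
          - partials is f y / f y * (partials [i] f y / f y))"
      unfolding r using has_partial_partials[OF f, of i "is"] has_partial_partials[OF f, of i "[]"] nz
      by (intro has_partial_divide) simp_all
    ultimately show ?thesis
      by (intro bexI[rotated]) simp_all
  qed
  note algebra_closed = generated_algebra_has_partial[OF this]
  have "has_partial i (\<lambda>y. ln (f y)) (\<lambda>y. partials [i] f y / f y)" for i
    using has_partial_partials[OF f, of i "[]"] pos by (intro has_partial_ln) simp_all
  then have closed: "\<exists>g\<in>insert (\<lambda>y. ln (f y)) (generated_algebra G). has_partial i r g"
    if "r \<in> insert (\<lambda>y. ln (f y)) (generated_algebra G)" for r i
    using that algebra_closed ratio[of "[i]"] by blast
  show ?thesis
    by (rule all_partials_exist_closed[OF _ closed]) simp
qed

section \<open>The Leibniz rule\<close>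

text \<open>The sum of \<open>F js ks\<close> over all \<open>2 ^ n\<close> splittings of the list
  into two complementary subsequences, as in the Leibniz rule for a product.\<close>

primrec leibniz_sum :: "'a list \<Rightarrow> ('a list \<Rightarrow> 'a list \<Rightarrow> real) \<Rightarrow> real" where
  "leibniz_sum [] F = F [] []"
| "leibniz_sum (i # is) F = leibniz_sum is (\<lambda>js ks. F (i # js) ks + F js (i # ks))"

lemma leibniz_sum_add:
  "leibniz_sum is (\<lambda>js ks. F js ks + G js ks) = leibniz_sum is F + leibniz_sum is G"
proof (induction "is" arbitrary: F G)
  case (Cons i "is")
  show ?case
    by (simp add: Cons.IH algebra_simps)
qed simp

lemma abs_leibniz_sum_le:
  assumes "\<And>js ks. length js + length ks = length is \<Longrightarrow> \<bar>F js ks\<bar> \<le> G js ks"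
  shows "\<bar>leibniz_sum is F\<bar> \<le> leibniz_sum is G"
  using assms
proof (induction "is" arbitrary: F G)
  case (Cons i "is")
  have "\<bar>F (i # js) ks + F js (i # ks)\<bar> \<le> G (i # js) ks + G js (i # ks)"
    if "length js + length ks = length is" for js ks
    using Cons.prems[of "i # js" ks] Cons.prems[of js "i # ks"] that
    by (intro order.trans[OF abs_triangle_ineq]) simp
  then show ?case
    by (simp add: Cons.IH)
qed simp

text \<open>Isolates the splitting with all indices on the left. In the Leibniz rule it carries the
  derivative of highest order, which can then be solved for.\<close>

lemma leibniz_sum_split:
  "leibniz_sum is F = F is [] + leibniz_sum is (\<lambda>js ks. if ks = [] then 0 else F js ks)"
proof (induction "is" arbitrary: F)
  case (Cons i "is")
  show ?case
    using Cons.IH[of "\<lambda>js. F (i # js)"] by (simp add: leibniz_sum_add)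
qed simp

text \<open>Exactly \<open>n choose k\<close> splittings put \<open>k\<close> indices on the right;
  the recursion of \<open>leibniz_sum\<close> becomes Pascal's rule.\<close>

lemma leibniz_sum_length:
  fixes H :: "nat \<Rightarrow> nat \<Rightarrow> real"
  shows "leibniz_sum is (\<lambda>js ks. H (length js) (length ks)) =
    (\<Sum>k\<le>length is. (length is choose k) * H (length is - k) k)"
proof (induction "is" arbitrary: H)
  case (Cons i "is")
  let ?n = "length is"
  have "leibniz_sum (i # is) (\<lambda>js ks. H (length js) (length ks)) =
      leibniz_sum is (\<lambda>js ks. H (Suc (length js)) (length ks))
      + leibniz_sum is (\<lambda>js ks. H (length js) (Suc (length ks)))"
    by (simp add: leibniz_sum_add)
  also have "leibniz_sum is (\<lambda>js ks. H (Suc (length js)) (length ks)) =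
      (\<Sum>k\<le>?n. (?n choose k) * H (Suc (?n - k)) k)"
    by (rule Cons.IH)
  \<comment> \<open>The added term \<open>k = Suc ?n\<close> has binomial coefficient 0 and allows
    the index shift that aligns the two sums.\<close>
  also have "\<dots> = (\<Sum>k\<le>Suc ?n. (?n choose k) * H (Suc ?n - k) k)"
    by (simp add: Suc_diff_le)
  also have "\<dots> = H (Suc ?n) 0 + (\<Sum>k\<le>?n. (?n choose Suc k) * H (?n - k) (Suc k))"
    by (subst sum.atMost_Suc_shift) simp
  also have "leibniz_sum is (\<lambda>js ks. H (length js) (Suc (length ks))) =
      (\<Sum>k\<le>?n. (?n choose k) * H (?n - k) (Suc k))"
    by (rule Cons.IH)
  also have "H (Suc ?n) 0 + (\<Sum>k\<le>?n. (?n choose Suc k) * H (?n - k) (Suc k))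
      + (\<Sum>k\<le>?n. (?n choose k) * H (?n - k) (Suc k)) =
      H (Suc ?n) 0 + (\<Sum>k\<le>?n. (Suc ?n choose Suc k) * H (?n - k) (Suc k))"
    by (simp add: sum.distrib algebra_simps)
  also have "\<dots> = (\<Sum>k\<le>Suc ?n. (Suc ?n choose k) * H (Suc ?n - k) k)"
    by (subst sum.atMost_Suc_shift) simp
  finally show ?case
    by simp
qed simp

lemma DERIV_leibniz_sum:
  assumes "\<And>js ks. ((\<lambda>h. F h js ks) has_real_derivative F' js ks) (at x)"
  shows "((\<lambda>h. leibniz_sum is (F h)) has_real_derivative leibniz_sum is F') (at x)"
  using assms by (induction "is" arbitrary: F F') (simp_all add: DERIV_add)

text \<open>The product rule applied in every summand reproduces the recursion of
  \<open>leibniz_sum\<close>.\<close>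

lemma partials_mult:
  assumes "all_partials_exist f" "all_partials_exist g"
  shows "partials is (\<lambda>y. f y * g y) y =
    leibniz_sum is (\<lambda>js ks. partials js f y * partials ks g y)"
proof -
  have "has_partial i (\<lambda>y. leibniz_sum is (\<lambda>js ks. partials js f y * partials ks g y))
      (\<lambda>y. leibniz_sum (i # is) (\<lambda>js ks. partials js f y * partials ks g y))" for i "is"
    using has_partial_mult[OF has_partial_partials[OF assms(1)] has_partial_partials[OF assms(2)]]
    unfolding has_partial_def leibniz_sum.simps
    by (intro allI DERIV_leibniz_sum) blast
  from partials_family(1)[of "\<lambda>is y. leibniz_sum is (\<lambda>js ks. partials js f y * partials ks g y)", OF this]
  show ?thesis
    by simp
qed

section \<open>Cumulants from moments\<close>

text \<open>In units of \<open>B ^ k\<close>: bounds the mean of a product of \<open>k\<close> centered variables whose uncentered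
  versions are bounded by \<open>B\<close>.\<close>

definition moment_bound :: "nat \<Rightarrow> real" where
  "moment_bound k = (if k = 0 then 1 else if k = 1 then 0 else if k = 3 then 4 / 3 else 2 ^ (k - 2))"

lemma moment_bound_nonneg: "0 \<le> moment_bound k"
  by (simp add: moment_bound_def)

lemma moment_bound_Suc_le: "n \<ge> 1 \<Longrightarrow> moment_bound (Suc n) \<le> 2 * fact n"
proof -
  assume "n \<ge> 1"
  have "moment_bound (Suc n) \<le> 2 ^ (n - 1)"
    using \<open>n \<ge> 1\<close> by (auto simp: moment_bound_def numeral_3_eq_3)
  also have "(2::real) ^ (n - 1) \<le> 2 * fact n"
    using \<open>n \<ge> 1\<close>
  proof (induction n rule: nat_induct_at_least)
    case (Suc n)
    then have "(2::real) ^ (Suc n - 1) = 2 * 2 ^ (n - 1)"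
      by (cases n) auto
    also have "\<dots> \<le> 2 * (2 * fact n)"
      using Suc by simp
    also have "\<dots> \<le> 2 * (real (Suc n) * fact n)"
      using Suc(1) by (intro mult_left_mono mult_right_mono) auto
    finally show ?case
      by simp
  qed simp
  finally show ?thesis .
qed

text \<open>The terms from 2 to 5 add up to 43/45. Later terms shrink by a factor of at most 1/3
  each, so together they are at most half the term at 5, which is 1/30.\<close>

lemma sum_moment_bound_le: "(\<Sum>j = 2..n. moment_bound j / fact j) \<le> 1"
proof -
  define t where "t = (\<lambda>j. moment_bound j / fact j)"
  have t_nonneg: "0 \<le> t j" for j
    by (simp add: t_def moment_bound_nonneg)
  \<comment> \<open>Half of the last term dominates the geometric tail; including it in the claim
    makes the induction go through.\<close>
  have large: "sum t {2..5 + n} + t (5 + n) / 2 \<le> 1" for n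
  proof (induction n)
    case 0
    show ?case
      by (simp add: t_def moment_bound_def numeral_eq_Suc atLeastAtMostSuc_conv)
  next
    case (Suc n)
    have "t (Suc (5 + n)) = 2 / real (n + 6) * t (5 + n)"
      by (simp add: t_def moment_bound_def numeral_eq_Suc field_simps)
    also have "\<dots> \<le> 1 / 3 * t (5 + n)"
      using t_nonneg by (intro mult_right_mono) (auto simp: field_simps)
    finally have "t (Suc (5 + n)) \<le> 1 / 3 * t (5 + n)" .
    moreover have "sum t {2..Suc (5 + n)} = sum t {2..5 + n} + t (Suc (5 + n))"
      by (subst sum.cl_ivl_Suc) simp
    ultimately show ?case
      using Suc unfolding add_Suc_right by linarith
  qed
  have "sum t {2..n} \<le> sum t {2..5 + n}"
    by (intro sum_mono2) (auto simp: t_nonneg)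
  also have "\<dots> \<le> 1"
    using large[of n] t_nonneg[of "5 + n"] by linarith
  finally show ?thesis
    by (simp add: t_def)
qed

text \<open>Here \<open>fact (Suc n)\<close> is shared out as
  \<open>(n - 1) * fact n + 2 * fact n\<close>. The sum fits in the first share because
  \<open>(n choose k) * fact (Suc n - k)\<close> is \<open>fact n * (Suc n - k) / fact k\<close>
  with \<open>k\<close> at least 2; the single moment fits in the second.\<close>

lemma sum_binomial_moment_bound_le:
  assumes "n \<ge> 1"
  shows "moment_bound (Suc n)
      + (\<Sum>k = 2..n. (n choose k) * (fact (Suc n - k) * moment_bound k)) \<le> fact (Suc n)"
proof -
  have "(\<Sum>k = 2..n. (n choose k) * (fact (Suc n - k) * moment_bound k))
      \<le> (\<Sum>k = 2..n. (fact n * (real n - 1)) * (moment_bound k / fact k))"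
  proof (rule sum_mono)
    fix k assume "k \<in> {2..n}"
    then have "(n choose k) * (fact (Suc n - k) * moment_bound k)
        = fact n * real (Suc n - k) * (moment_bound k / fact k)"
      by (simp add: binomial_fact Suc_diff_le)
    also have "\<dots> \<le> fact n * (real n - 1) * (moment_bound k / fact k)"
      using \<open>k \<in> {2..n}\<close>
      by (intro mult_right_mono mult_left_mono) (auto simp: moment_bound_nonneg)
    finally show "(n choose k) * (fact (Suc n - k) * moment_bound k)
        \<le> fact n * (real n - 1) * (moment_bound k / fact k)" .
  qed
  also have "\<dots> = fact n * (real n - 1) * (\<Sum>k = 2..n. moment_bound k / fact k)"
    by (simp add: sum_distrib_left)
  also have "\<dots> \<le> fact n * (real n - 1) * 1"
    using assms by (intro mult_left_mono sum_moment_bound_le) auto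
  finally show ?thesis
    using moment_bound_Suc_le[OF assms] by (simp add: algebra_simps)
qed

text \<open>Strong induction on the order. Since \<open>f\<close> is 1 with zero gradient at
  \<open>y\<close>, the Leibniz rule expresses a derivative of the logarithm by one moment and by
  products of moments with derivatives at least two orders lower.\<close>

lemma abs_partials_ln_le:
  fixes f :: "real ^ 'n \<Rightarrow> real"
  assumes f: "all_partials_exist f" and pos: "\<And>y. f y > 0"
    and "f y = 1" and first: "\<And>i. partials [i] f y = 0"
    and bound: "\<And>is. \<bar>partials is f y\<bar> \<le> moment_bound (length is) * B ^ length is"
    and "B \<ge> 0" and "is \<noteq> []"
  shows "\<bar>partials is (\<lambda>y. ln (f y)) y\<bar> \<le> fact (length is) * B ^ length is"
  using \<open>is \<noteq> []\<close>
proof (induction "length is" arbitrary: "is" rule: less_induct)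
  case less
  define u where "u = (\<lambda>y. ln (f y))"
  have u: "all_partials_exist u"
    unfolding u_def by (rule all_partials_exist_ln[OF f pos])
  \<comment> \<open>\<open>partials\<close> differentiates in the last listed direction first, so
    peeling off the last index leaves \<open>partials js\<close> acting on a first
    derivative.\<close>
  obtain js i where is_eq: "is = js @ [i]"
    using less.prems by (cases "is" rule: rev_cases) auto
  have f_i: "partials [i] f = (\<lambda>y. partials [i] u y * f y)"
  proof -
    have "has_partial i u (\<lambda>y. partials [i] f y / f y)"
      unfolding u_def using has_partial_partials[OF f, of i "[]"] pos
      by (intro has_partial_ln) simp_all
    then have "partials [i] u = (\<lambda>y. partials [i] f y / f y)"
      by (rule partials_singleton_eq)
    then show ?thesis
      using pos by (simp add: less_imp_neq[symmetric])
  qed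
  define F where "F = (\<lambda>ks ls. partials (ks @ [i]) u y * partials ls f y)"
  have "partials is f y = partials js (\<lambda>y. partials [i] u y * f y) y"
    unfolding is_eq partials_append f_i ..
  also have "\<dots> = leibniz_sum js F"
    unfolding F_def partials_append
    by (rule partials_mult[OF all_partials_exist_partials[OF u] f])
  also have "\<dots> = partials is u y + leibniz_sum js (\<lambda>ks ls. if ls = [] then 0 else F ks ls)"
    by (subst leibniz_sum_split) (simp add: F_def is_eq \<open>f y = 1\<close>)
  finally have rec: "partials is u y =
      partials is f y - leibniz_sum js (\<lambda>ks ls. if ls = [] then 0 else F ks ls)"
    by simp
  let ?n = "length js"
  show ?case
  proof (cases "js = []")
    case True
    then show ?thesis
      using rec first[of i] \<open>B \<ge> 0\<close> by (simp add: is_eq u_def)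
  next
    case False
    \<comment> \<open>The value 0 for \<open>l < 2\<close> covers the split-off empty
      \<open>ls\<close> and singletons, which meet the zero gradient. The power of \<open>B\<close>
      is constant because the orders of the two factors add up to \<open>Suc ?n\<close>.\<close>
    define H where "H = (\<lambda>k l. (if l < 2 then 0 else fact (Suc k) * moment_bound l) * B ^ Suc ?n)"
    have "\<bar>leibniz_sum js (\<lambda>ks ls. if ls = [] then 0 else F ks ls)\<bar>
        \<le> leibniz_sum js (\<lambda>ks ls. H (length ks) (length ls))"
    proof (rule abs_leibniz_sum_le)
      fix ks ls :: "'n list"
      assume len: "length ks + length ls = length js"
      \<comment> \<open>\<open>remdups_adj.cases\<close> serves only to separate lists of length 0,
        1 and at least 2.\<close>
      consider "ls = []" | j where "ls = [j]" | "length ls \<ge> 2"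
        by (cases ls rule: remdups_adj.cases) auto
      then show "\<bar>if ls = [] then 0 else F ks ls\<bar> \<le> H (length ks) (length ls)"
      proof cases
        case 3
        have "\<bar>F ks ls\<bar> = \<bar>partials (ks @ [i]) u y\<bar> * \<bar>partials ls f y\<bar>"
          by (simp add: F_def abs_mult)
        also have "\<dots> \<le> (fact (Suc (length ks)) * B ^ Suc (length ks))
            * (moment_bound (length ls) * B ^ length ls)"
          using less.hyps[of "ks @ [i]"] bound[of ls] len 3 \<open>B \<ge> 0\<close>
          by (intro mult_mono) (auto simp: is_eq u_def)
        also have "\<dots> = fact (Suc (length ks)) * moment_bound (length ls) * B ^ Suc ?n"
          unfolding len[symmetric] by (simp add: power_add)
        finally show ?thesis
          using 3 by (auto simp: H_def)
      qed (use first in \<open>simp_all add: H_def F_def\<close>)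
    qed
    also have "\<dots> = (\<Sum>k\<le>?n. (?n choose k) * H (?n - k) k)"
      by (rule leibniz_sum_length)
    also have "\<dots> = (\<Sum>k = 2..?n. (?n choose k) * H (?n - k) k)"
      by (intro sum.mono_neutral_right) (auto simp: H_def)
    also have "\<dots> = (\<Sum>k = 2..?n. (?n choose k) * (fact (Suc ?n - k) * moment_bound k)) * B ^ Suc ?n"
      unfolding sum_distrib_right by (intro sum.cong) (auto simp: H_def Suc_diff_le)
    finally have "\<bar>partials is u y\<bar> \<le> (moment_bound (Suc ?n)
        + (\<Sum>k = 2..?n. (?n choose k) * (fact (Suc ?n - k) * moment_bound k))) * B ^ Suc ?n"
      using bound[of "is"] unfolding rec by (simp add: is_eq algebra_simps)
    also have "\<dots> \<le> fact (Suc ?n) * B ^ Suc ?n"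
      using False \<open>B \<ge> 0\<close>
      by (intro mult_right_mono sum_binomial_moment_bound_le) (auto simp: Suc_le_eq)
    finally show ?thesis
      by (simp add: u_def is_eq)
  qed
qed

section \<open>Exponential moments of a bounded random vector\<close>

text \<open>Dominated convergence for the difference quotients. The point \<open>h = 0\<close> is
  enough, since the exponential at any base point can be absorbed into \<open>G\<close>.\<close>

lemma (in finite_measure) DERIV_exp_integral:
  assumes [measurable]: "G \<in> borel_measurable M" "a \<in> borel_measurable M"
    and G: "AE \<omega> in M. \<bar>G \<omega>\<bar> \<le> C" and a: "AE \<omega> in M. \<bar>a \<omega>\<bar> \<le> A"
  shows "((\<lambda>h. \<integral>\<omega>. G \<omega> * exp (h * a \<omega>) \<partial>M) has_real_derivative (\<integral>\<omega>. G \<omega> * a \<omega> \<partial>M)) (at 0)"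
proof -
  have integrable_exp: "integrable M (\<lambda>\<omega>. G \<omega> * exp (h * a \<omega>))" for h
  proof (rule integrable_const_bound)
    show "AE \<omega> in M. norm (G \<omega> * exp (h * a \<omega>)) \<le> C * exp (\<bar>h\<bar> * A)"
      using G a
    proof eventually_elim
      case (elim \<omega>)
      have "h * a \<omega> \<le> \<bar>h\<bar> * A"
        using mult_left_mono[OF elim(2), of "\<bar>h\<bar>"] abs_ge_self[of "h * a \<omega>"] by (simp add: abs_mult)
      then show ?case
        using elim(1) by (auto simp: abs_mult intro!: mult_mono)
    qed
  qed simp
  \<comment> \<open>The dominating constant, uniform in \<open>h\<close>; it comes from bounding
    \<open>exp u - 1\<close> by \<open>u * exp u\<close> in absolute values, at
    \<open>u = h * x\<close>.\<close>
  have quotient_le: "\<bar>(exp (h * x) - 1) / h\<bar> \<le> A * exp A"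
    if "\<bar>h\<bar> \<le> 1" "h \<noteq> 0" "\<bar>x\<bar> \<le> A" for h x :: real
  proof -
    define u where "u = h * x"
    have u: "\<bar>u\<bar> \<le> A" "\<bar>u\<bar> \<le> \<bar>h\<bar> * A"
      using that mult_mono[of "\<bar>h\<bar>" 1 "\<bar>x\<bar>" A] mult_left_mono[of "\<bar>x\<bar>" A "\<bar>h\<bar>"]
      by (auto simp: u_def abs_mult)
    have "exp u - 1 \<le> u * exp u"
      using exp_ge_add_one_self[of "- u"] by (simp add: exp_minus field_simps)
    then have "\<bar>exp u - 1\<bar> \<le> \<bar>u\<bar> * exp \<bar>u\<bar>"
    proof (cases "u \<ge> 0")
      case False
      have "1 - exp u \<le> - u"
        using exp_ge_add_one_self[of u] by linarith
      also have "- u * 1 \<le> - u * exp (- u)"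
        using False by (intro mult_left_mono) auto
      finally show ?thesis
        using False by simp
    qed simp
    also have "\<dots> \<le> (\<bar>h\<bar> * A) * exp A"
      using u that by (intro mult_mono) auto
    finally have "\<bar>exp u - 1\<bar> / \<bar>h\<bar> \<le> A * exp A"
      using \<open>h \<noteq> 0\<close> by (simp add: pos_divide_le_eq mult_ac)
    then show ?thesis
      by (simp add: u_def)
  qed
  have "((\<lambda>h. \<integral>\<omega>. G \<omega> * ((exp (h * a \<omega>) - 1) / h) \<partial>M) \<longlongrightarrow> (\<integral>\<omega>. G \<omega> * a \<omega> \<partial>M)) (at 0)"
    unfolding tendsto_at_iff_sequentially comp_def
  proof (intro allI impI)
    fix X :: "nat \<Rightarrow> real"
    assume X: "\<forall>n. X n \<in> UNIV - {0}" and lim: "X \<longlonglongrightarrow> 0"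
    \<comment> \<open>The domination needs \<open>h\<close> of absolute value at most 1, so an
      initial segment of the sequence is skipped.\<close>
    from lim have "\<forall>\<^sub>F n in sequentially. \<bar>X n\<bar> < 1"
      by (auto simp: tendsto_iff dist_real_def dest: spec[of _ 1])
    then obtain N where "\<And>n. n \<ge> N \<Longrightarrow> \<bar>X n\<bar> < 1"
      unfolding eventually_sequentially by blast
    then have N: "\<bar>X (n + N)\<bar> \<le> 1" for n
      by (simp add: less_imp_le)
    have "(\<lambda>n. \<integral>\<omega>. G \<omega> * ((exp (X (n + N) * a \<omega>) - 1) / X (n + N)) \<partial>M)
        \<longlonglongrightarrow> (\<integral>\<omega>. G \<omega> * a \<omega> \<partial>M)"
    proof (rule integral_dominated_convergence[where w = "\<lambda>_. C * (A * exp A)"])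
      show "AE \<omega> in M. (\<lambda>n. G \<omega> * ((exp (X (n + N) * a \<omega>) - 1) / X (n + N))) \<longlonglongrightarrow> G \<omega> * a \<omega>"
      proof (intro AE_I2 tendsto_mult tendsto_const)
        fix \<omega>
        have "((\<lambda>h. exp (h * a \<omega>)) has_real_derivative a \<omega>) (at 0)"
          by (auto intro!: derivative_eq_intros)
        then have "((\<lambda>h. (exp (h * a \<omega>) - 1) / h) \<longlongrightarrow> a \<omega>) (at 0)"
          by (simp add: has_field_derivative_iff)
        then have "(\<lambda>n. (exp (X n * a \<omega>) - 1) / X n) \<longlonglongrightarrow> a \<omega>"
          unfolding tendsto_at_iff_sequentially comp_def using X lim by blast
        then show "(\<lambda>n. (exp (X (n + N) * a \<omega>) - 1) / X (n + N)) \<longlonglongrightarrow> a \<omega>"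
          by (rule LIMSEQ_ignore_initial_segment)
      qed
      show "AE \<omega> in M. norm (G \<omega> * ((exp (X (n + N) * a \<omega>) - 1) / X (n + N))) \<le> C * (A * exp A)" for n
        using G a
      proof eventually_elim
        case (elim \<omega>)
        have "X (n + N) \<noteq> 0"
          using X by blast
        then show ?case
          unfolding real_norm_def abs_mult
          using elim quotient_le[OF N] by (intro mult_mono) auto
      qed
    qed auto
    then show "(\<lambda>n. \<integral>\<omega>. G \<omega> * ((exp (X n * a \<omega>) - 1) / X n) \<partial>M)
        \<longlonglongrightarrow> (\<integral>\<omega>. G \<omega> * a \<omega> \<partial>M)"
      by (rule LIMSEQ_offset)
  qed
  moreover have "(\<integral>\<omega>. G \<omega> * ((exp (h * a \<omega>) - 1) / h) \<partial>M) =
      ((\<integral>\<omega>. G \<omega> * exp (h * a \<omega>) \<partial>M) - (\<integral>\<omega>. G \<omega> * exp (0 * a \<omega>) \<partial>M)) / h" for h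
  proof -
    have "(\<integral>\<omega>. G \<omega> * ((exp (h * a \<omega>) - 1) / h) \<partial>M) =
        (\<integral>\<omega>. (G \<omega> * exp (h * a \<omega>) - G \<omega> * exp (0 * a \<omega>)) / h \<partial>M)"
      by (simp add: algebra_simps)
    then show ?thesis
      by (simp only: integral_divide_zero Bochner_Integration.integral_diff[OF integrable_exp integrable_exp])
  qed
  ultimately show ?thesis
    by (simp only: has_field_derivative_iff add_0 diff_zero)
qed

lemma borel_measurable_component [measurable (raw)]:
  fixes X :: "'a \<Rightarrow> real ^ 'n"
  assumes "X \<in> borel_measurable M"
  shows "(\<lambda>\<omega>. X \<omega> $ i) \<in> borel_measurable M"
  using assms borel_measurable_nth by (rule measurable_compose)

locale bounded_vector = finite_measure +
  fixes X :: "'a \<Rightarrow> real ^ 'n" and A :: real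
  assumes measurable_X [measurable]: "X \<in> borel_measurable M"
    and X_bounded: "AE \<omega> in M. \<forall>i. \<bar>X \<omega> $ i\<bar> \<le> A"
begin

lemma measurable_prod_list_X [measurable]:
  "(\<lambda>\<omega>. \<Prod>i\<leftarrow>is. X \<omega> $ i) \<in> borel_measurable M"
  by (induction "is") auto

lemma AE_prod_list_X: "AE \<omega> in M. \<bar>\<Prod>i\<leftarrow>is. X \<omega> $ i\<bar> \<le> A ^ length is"
  using X_bounded
proof eventually_elim
  case (elim \<omega>)
  then have "0 \<le> A"
    by (meson abs_ge_zero order.trans)
  show ?case
  proof (induction "is")
    case (Cons i "is")
    then show ?case
      using elim \<open>0 \<le> A\<close> by (auto simp: abs_mult intro!: mult_mono)
  qed simp
qed

text \<open>For a probability measure, the empty list gives the moment generating function of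
  \<open>X\<close>. Other lists give its partial derivatives, whose values at 0 are the joint
  moments.\<close>

definition exp_moment :: "'n list \<Rightarrow> real ^ 'n \<Rightarrow> real" where
  "exp_moment is y = (\<integral>\<omega>. (\<Prod>i\<leftarrow>is. X \<omega> $ i) * exp (X \<omega> \<bullet> y) \<partial>M)"

lemma inner_X_le: "AE \<omega> in M. \<bar>X \<omega> \<bullet> y\<bar> \<le> A * (\<Sum>i\<in>UNIV. \<bar>y $ i\<bar>)"
  using X_bounded
proof eventually_elim
  case (elim \<omega>)
  have "\<bar>X \<omega> \<bullet> y\<bar> \<le> (\<Sum>i\<in>UNIV. \<bar>X \<omega> $ i\<bar> * \<bar>y $ i\<bar>)"
    unfolding inner_vec_def by (intro order.trans[OF sum_abs]) (simp add: abs_mult)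
  also have "\<dots> \<le> (\<Sum>i\<in>UNIV. A * \<bar>y $ i\<bar>)"
    using elim by (intro sum_mono mult_right_mono) auto
  finally show ?case
    by (simp add: sum_distrib_left)
qed

lemma integrable_prod_list_exp:
  "integrable M (\<lambda>\<omega>. (\<Prod>i\<leftarrow>is. X \<omega> $ i) * exp (X \<omega> \<bullet> y))"
proof (rule integrable_const_bound)
  show "AE \<omega> in M. norm ((\<Prod>i\<leftarrow>is. X \<omega> $ i) * exp (X \<omega> \<bullet> y))
      \<le> A ^ length is * exp (A * (\<Sum>i\<in>UNIV. \<bar>y $ i\<bar>))"
    using AE_prod_list_X[of "is"] inner_X_le[of y]
    by eventually_elim (auto simp: abs_mult intro!: mult_mono)
qed simp

text \<open>A shift of \<open>y\<close> by \<open>h\<close> along axis \<open>i\<close> multiplies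
  the integrand by \<open>exp (h * X \<omega> $ i)\<close>.\<close>

lemma has_partial_exp_moment: "has_partial i (exp_moment is) (exp_moment (i # is))"
  unfolding has_partial_def
proof
  fix y
  define G where "G = (\<lambda>\<omega>. (\<Prod>i\<leftarrow>is. X \<omega> $ i) * exp (X \<omega> \<bullet> y))"
  have "((\<lambda>h. \<integral>\<omega>. G \<omega> * exp (h * X \<omega> $ i) \<partial>M) has_real_derivative (\<integral>\<omega>. G \<omega> * X \<omega> $ i \<partial>M)) (at 0)"
  proof (rule DERIV_exp_integral)
    show "AE \<omega> in M. \<bar>G \<omega>\<bar> \<le> A ^ length is * exp (A * (\<Sum>i\<in>UNIV. \<bar>y $ i\<bar>))"
      using AE_prod_list_X[of "is"] inner_X_le[of y]
      by eventually_elim (auto simp: G_def abs_mult intro!: mult_mono)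
    show "AE \<omega> in M. \<bar>X \<omega> $ i\<bar> \<le> A"
      using X_bounded by eventually_elim simp
  qed (simp_all add: G_def)
  moreover have "(\<integral>\<omega>. G \<omega> * exp (h * X \<omega> $ i) \<partial>M) = exp_moment is (y + h *\<^sub>R axis i 1)" for h
    by (simp add: exp_moment_def G_def inner_add_right inner_axis exp_add mult.assoc)
  moreover have "(\<integral>\<omega>. G \<omega> * X \<omega> $ i \<partial>M) = exp_moment (i # is) y"
    by (simp add: exp_moment_def G_def mult_ac)
  ultimately show "((\<lambda>h. exp_moment is (y + h *\<^sub>R axis i 1)) has_real_derivative
      exp_moment (i # is) y) (at 0)"
    by simp
qed

lemmas partials_exp_moment = partials_family[of exp_moment, OF has_partial_exp_moment]

lemma exp_moment_pos:
  assumes "emeasure M (space M) \<noteq> 0"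
  shows "exp_moment [] y > 0"
proof -
  have "exp_moment [] y \<noteq> 0"
  proof
    assume "exp_moment [] y = 0"
    then have "AE \<omega> in M. exp (X \<omega> \<bullet> y) = 0"
      using integrable_prod_list_exp[of "[]" y]
      by (subst (asm) exp_moment_def) (simp add: integral_nonneg_eq_0_iff_AE)
    then have "AE \<omega> in M. False"
      by simp
    with assms show False
      unfolding ae_filter_eq_bot_iff[symmetric] trivial_limit_def by (rule notE)
  qed
  moreover have "exp_moment [] y \<ge> 0"
    by (simp add: exp_moment_def)
  ultimately show ?thesis
    by simp
qed

end

section \<open>Translations and quadratic polynomials\<close>

text \<open>Moves the base point of the expansion to the origin, where exponential moments are
  moments.\<close>

lemma partials_translate:
  fixes f :: "real ^ 'n \<Rightarrow> real"
  assumes "all_partials_exist f"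
  shows "partials is (\<lambda>y. f (y - a)) y = partials is f (y - a)"
    and "all_partials_exist (\<lambda>y. f (y - a))"
proof -
  have "has_partial i (\<lambda>y. partials is f (y - a)) (\<lambda>y. partials (i # is) f (y - a))" 
    for i and "is" :: "'n list"
    unfolding has_partial_def
  proof
    fix y :: "real ^ 'n"
    have "((\<lambda>h. partials is f (y - a + h *\<^sub>R axis i 1)) has_real_derivative
        partials (i # is) f (y - a)) (at 0)"
      using has_partial_partials[OF assms] unfolding has_partial_def by blast
    then show "((\<lambda>h. partials is f (y + h *\<^sub>R axis i 1 - a)) has_real_derivative
        partials (i # is) f (y - a)) (at 0)"
      by (simp add: algebra_simps del: partials.simps)
  qed
  from partials_family[of "\<lambda>is y. partials is f (y - a)", OF this]
  show "partials is (\<lambda>y. f (y - a)) y = partials is f (y - a)"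
    and "all_partials_exist (\<lambda>y. f (y - a))"
    by simp_all
qed

text \<open>A table of all iterated partials of the quadratic polynomial in the first equation, in
  the form that \<open>partials_family\<close> takes.\<close>

fun quadratic_partials :: "real \<Rightarrow> real ^ 'n \<Rightarrow> real \<Rightarrow> 'n list \<Rightarrow> real ^ 'n \<Rightarrow> real" where
  "quadratic_partials k v s [] y = k + v \<bullet> y - (norm y)\<^sup>2 / (2 * s)"
| "quadratic_partials k v s [i] y = v $ i - y $ i / s"
| "quadratic_partials k v s [i, j] y = (if i = j then - 1 / s else 0)"
| "quadratic_partials k v s (i # j # l # is) y = 0"

lemma quadratic_partials_eq_0: "length is \<ge> 3 \<Longrightarrow> quadratic_partials k v s is y = 0"
  by (induction k v s "is" y rule: quadratic_partials.induct) simp_all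

lemma has_partial_quadratic:
  fixes i :: "'n::finite"
  shows "has_partial i (quadratic_partials k v s is) (quadratic_partials k v s (i # is))"
  unfolding has_partial_def
proof
  fix y :: "real ^ 'n"
  show "((\<lambda>h. quadratic_partials k v s is (y + h *\<^sub>R axis i 1)) has_real_derivative
      quadratic_partials k v s (i # is) y) (at 0)"
  proof (cases "(k, v, s, is, y)" rule: quadratic_partials.cases)
    case 1
    then have "is = []"
      by simp
    have expand: "quadratic_partials k v s [] (y + h *\<^sub>R axis i 1) = k + v \<bullet> y + v $ i * h
        - ((norm y)\<^sup>2 + 2 * y $ i * h + h\<^sup>2) * (1 / (2 * s))" for h
    proof -
      have "(norm (y + h *\<^sub>R axis i 1))\<^sup>2 = (norm y)\<^sup>2 + 2 * y $ i * h + h\<^sup>2"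
        unfolding power2_norm_eq_inner
        by (simp add: inner_add_left inner_add_right inner_axis inner_axis' power2_eq_square
            distrib_left)
      then show ?thesis
        by (simp add: inner_add_right inner_axis)
    qed
    have "((\<lambda>h. a\<^sub>0 + a\<^sub>1 * h - (n\<^sub>0 + n\<^sub>1 * h + h\<^sup>2) * r) has_real_derivative
        a\<^sub>1 - n\<^sub>1 * r) (at 0)" for a\<^sub>0 a\<^sub>1 n\<^sub>0 n\<^sub>1 r :: real
      by (auto intro!: derivative_eq_intros)
    from this[of "k + v \<bullet> y" "v $ i" "(norm y)\<^sup>2" "2 * y $ i" "1 / (2 * s)"]
    have "((\<lambda>h. k + v \<bullet> y + v $ i * h
        - ((norm y)\<^sup>2 + 2 * y $ i * h + h\<^sup>2) * (1 / (2 * s))) has_real_derivative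
        v $ i - 2 * y $ i * (1 / (2 * s))) (at 0)" .
    also have "v $ i - 2 * y $ i * (1 / (2 * s)) = quadratic_partials k v s [i] y"
      by simp
    finally show ?thesis
      unfolding \<open>is = []\<close> expand .
  next
    case (2 _ _ _ j)
    then have "is = [j]"
      by simp
    have affine: "quadratic_partials k v s [j] (y + h *\<^sub>R axis i 1) =
        (v $ j - y $ j / s) + (if i = j then - 1 / s else 0) * h" for h
      by (simp add: axis_def add_divide_distrib)
    have "((\<lambda>h. a\<^sub>0 + a\<^sub>1 * h) has_real_derivative a\<^sub>1) (at 0)" for a\<^sub>0 a\<^sub>1 :: real
      by (auto intro!: derivative_eq_intros)
    then show ?thesis
      unfolding \<open>is = [j]\<close> affine quadratic_partials.simps(3) .
  next
    case (3 _ _ _ j l)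
    then have "is = [j, l]"
      by simp
    show ?thesis
      unfolding \<open>is = [j, l]\<close> quadratic_partials.simps by (rule DERIV_const)
  next
    case (4 _ _ _ j l m ls)
    then have "is = j # l # m # ls"
      by simp
    show ?thesis
      unfolding \<open>is = j # l # m # ls\<close> quadratic_partials.simps by (rule DERIV_const)
  qed
qed

lemmas partials_quadratic = partials_family[of "quadratic_partials k v s" for k v s, OF has_partial_quadratic]

section \<open>Moments and cumulants of a centered bounded vector\<close>

text \<open>Reduces a mixed third moment to third moments of single components.\<close>

lemma am_gm_cubes:
  fixes x y z :: real
  assumes "x \<ge> 0" "y \<ge> 0" "z \<ge> 0"
  shows "x * y * z \<le> (x ^ 3 + y ^ 3 + z ^ 3) / 3"
proof -
  have "x ^ 3 + y ^ 3 + z ^ 3 - 3 * (x * y * z) =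
      (x + y + z) * ((x - y)\<^sup>2 + (y - z)\<^sup>2 + (z - x)\<^sup>2) / 2"
    by (simp add: power3_eq_cube power2_eq_square field_simps)
  also have "\<dots> \<ge> 0"
    using assms by simp
  finally show ?thesis
    by simp
qed

text \<open>\<open>b + X\<close> is the original vector, bounded by \<open>B\<close>, and
  \<open>b\<close> is its mean. Keeping \<open>b\<close> explicit lets the variance bound depend on
  it, which the third moment bound exploits.\<close>

locale centered_vector = prob_space +
  fixes X :: "'a \<Rightarrow> real ^ 'n" and b :: "real ^ 'n" and B :: real
  assumes measurable_X: "X \<in> borel_measurable M"
    and centered: "expectation (\<lambda>\<omega>. X \<omega> $ i) = 0"
    and uncentered_bounded: "AE \<omega> in M. \<forall>i. \<bar>b $ i + X \<omega> $ i\<bar> \<le> B"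
begin

lemma integrable_component: "integrable M (\<lambda>\<omega>. X \<omega> $ i)"
proof (rule integrable_const_bound)
  show "AE \<omega> in M. norm (X \<omega> $ i) \<le> B + \<bar>b $ i\<bar>"
    using uncentered_bounded
  proof eventually_elim
    case (elim \<omega>)
    from spec[OF elim, of i] show ?case
      unfolding real_norm_def by linarith
  qed
qed (rule borel_measurable_component[OF measurable_X])

lemma mean_le: "\<bar>b $ i\<bar> \<le> B"
proof -
  have int: "integrable M (\<lambda>\<omega>. b $ i + X \<omega> $ i)"
    using integrable_component by simp
  have eq: "expectation (\<lambda>\<omega>. b $ i + X \<omega> $ i) = b $ i"
    using integrable_component centered prob_space by simp
  have "AE \<omega> in M. b $ i + X \<omega> $ i \<le> B" "AE \<omega> in M. - B \<le> b $ i + X \<omega> $ i"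
    using uncentered_bounded by (auto elim!: eventually_mono dest!: spec[of _ i])
  then have "b $ i \<le> B" "- B \<le> b $ i"
    using integral_le_const[OF int, of B] integral_ge_const[OF int, of "- B"] eq by auto
  then show ?thesis
    by linarith
qed

lemma B_nonneg: "0 \<le> B"
  using mean_le by (meson abs_ge_zero order.trans)

lemma component_le: "AE \<omega> in M. \<forall>i. \<bar>X \<omega> $ i\<bar> \<le> B + \<bar>b $ i\<bar>"
  using uncentered_bounded
proof eventually_elim
  case (elim \<omega>)
  show ?case
  proof
    fix i
    from spec[OF elim, of i] show "\<bar>X \<omega> $ i\<bar> \<le> B + \<bar>b $ i\<bar>"
      by linarith
  qed
qed

sublocale bounded_vector M X "2 * B"
proof
  show "AE \<omega> in M. \<forall>i. \<bar>X \<omega> $ i\<bar> \<le> 2 * B"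
    using component_le
  proof eventually_elim
    case (elim \<omega>)
    show ?case
    proof
      fix i
      from spec[OF elim, of i] mean_le[of i] show "\<bar>X \<omega> $ i\<bar> \<le> 2 * B"
        by linarith
    qed
  qed
qed (rule measurable_X)

lemma integrable_power_component: "integrable M (\<lambda>\<omega>. \<bar>X \<omega> $ i\<bar> ^ k)"
proof (rule integrable_const_bound)
  show "AE \<omega> in M. norm (\<bar>X \<omega> $ i\<bar> ^ k) \<le> (2 * B) ^ k"
    using X_bounded
  proof eventually_elim
    case (elim \<omega>)
    then show ?case
      using power_mono[of "\<bar>X \<omega> $ i\<bar>" "2 * B" k] by simp
  qed
qed simp

text \<open>Centering removes the cross term in the second moment of
  \<open>b $ i + X \<omega> $ i\<close>, which is at most \<open>B\<^sup>2\<close>.\<close>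

lemma second_moment_le: "expectation (\<lambda>\<omega>. \<bar>X \<omega> $ i\<bar> ^ 2) \<le> B\<^sup>2 - (b $ i)\<^sup>2"
proof -
  have int2: "integrable M (\<lambda>\<omega>. (X \<omega> $ i)\<^sup>2)"
    using integrable_power_component[of i 2] by simp
  have eq: "(b $ i + X \<omega> $ i)\<^sup>2 = (b $ i)\<^sup>2 + (2 * b $ i) * X \<omega> $ i + (X \<omega> $ i)\<^sup>2" for \<omega>
    by (simp add: power2_sum)
  have int: "integrable M (\<lambda>\<omega>. (b $ i + X \<omega> $ i)\<^sup>2)"
    unfolding eq using integrable_component int2 by simp
  have "(b $ i)\<^sup>2 + expectation (\<lambda>\<omega>. (X \<omega> $ i)\<^sup>2) = expectation (\<lambda>\<omega>. (b $ i + X \<omega> $ i)\<^sup>2)"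
    unfolding eq using integrable_component int2 centered[of i] prob_space by simp
  also have "\<dots> \<le> B\<^sup>2"
  proof (rule integral_le_const[OF int])
    show "AE \<omega> in M. (b $ i + X \<omega> $ i)\<^sup>2 \<le> B\<^sup>2"
      using uncentered_bounded
    proof eventually_elim
      case (elim \<omega>)
      then have "\<bar>b $ i + X \<omega> $ i\<bar>\<^sup>2 \<le> B\<^sup>2"
        by (intro power_mono) auto
      then show ?case
        by simp
    qed
  qed
  finally show ?thesis
    by simp
qed

text \<open>One factor is bounded by \<open>B + \<bar>b $ i\<bar>\<close>, the remaining square by
  the variance estimate; the product is then maximised over the mean.\<close>

lemma third_moment_le: "expectation (\<lambda>\<omega>. \<bar>X \<omega> $ i\<bar> ^ 3) \<le> 4 / 3 * B ^ 3"
proof -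
  let ?m = "\<bar>b $ i\<bar>"
  have "expectation (\<lambda>\<omega>. \<bar>X \<omega> $ i\<bar> ^ 3) \<le> expectation (\<lambda>\<omega>. (B + ?m) * \<bar>X \<omega> $ i\<bar> ^ 2)"
  proof (rule integral_mono_AE)
    show "AE \<omega> in M. \<bar>X \<omega> $ i\<bar> ^ 3 \<le> (B + ?m) * \<bar>X \<omega> $ i\<bar> ^ 2"
      using component_le
    proof eventually_elim
      case (elim \<omega>)
      then show ?case
        using mult_right_mono[OF spec[OF elim, of i], of "\<bar>X \<omega> $ i\<bar> ^ 2"]
        by (simp add: power3_eq_cube power2_eq_square mult.assoc)
    qed
  qed (intro integrable_mult_right integrable_power_component)+
  also have "\<dots> = (B + ?m) * expectation (\<lambda>\<omega>. \<bar>X \<omega> $ i\<bar> ^ 2)"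
    by (rule integral_mult_right_zero)
  also have "\<dots> \<le> (B + ?m) * (B\<^sup>2 - ?m\<^sup>2)"
    using second_moment_le[of i] B_nonneg by (intro mult_left_mono) auto
  \<comment> \<open>For \<open>?m\<close> nonnegative the maximum is at \<open>?m = B / 3\<close>
    with value \<open>32 / 27 * B ^ 3\<close>, hence the double root there.\<close>
  also have "\<dots> = 32 / 27 * B ^ 3 - (?m - B / 3)\<^sup>2 * (?m + 5 / 3 * B)"
    by (simp add: power3_eq_cube power2_eq_square field_simps)
  also have "\<dots> \<le> 32 / 27 * B ^ 3"
    using B_nonneg by simp
  also have "\<dots> \<le> 4 / 3 * B ^ 3"
    using B_nonneg by (intro mult_right_mono) auto
  finally show ?thesis .
qed

lemma integrable_prod_list: "integrable M (\<lambda>\<omega>. \<Prod>i\<leftarrow>is. X \<omega> $ i)"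
  using integrable_prod_list_exp[of "is" 0] by simp

text \<open>The arithmetic-geometric mean inequality reduces two factors to second moments; every
  other factor is at most \<open>2 * B\<close>.\<close>

lemma product_moment_le_square:
  "\<bar>expectation (\<lambda>\<omega>. \<Prod>i\<leftarrow>i # j # is. X \<omega> $ i)\<bar> \<le> (2 * B) ^ length is * B\<^sup>2"
proof -
  let ?S = "\<lambda>\<omega>. (2 * B) ^ length is * ((\<bar>X \<omega> $ i\<bar> ^ 2 + \<bar>X \<omega> $ j\<bar> ^ 2) / 2)"
  have "\<bar>expectation (\<lambda>\<omega>. \<Prod>i\<leftarrow>i # j # is. X \<omega> $ i)\<bar>
      \<le> expectation (\<lambda>\<omega>. \<bar>\<Prod>i\<leftarrow>i # j # is. X \<omega> $ i\<bar>)"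
    by (rule integral_abs_bound)
  also have "\<dots> \<le> expectation ?S"
  proof (rule integral_mono_AE)
    show "AE \<omega> in M. \<bar>\<Prod>i\<leftarrow>i # j # is. X \<omega> $ i\<bar> \<le> ?S \<omega>"
      using AE_prod_list_X[of "is"]
    proof eventually_elim
      case (elim \<omega>)
      have "\<bar>X \<omega> $ i\<bar> * \<bar>X \<omega> $ j\<bar> \<le> (\<bar>X \<omega> $ i\<bar> ^ 2 + \<bar>X \<omega> $ j\<bar> ^ 2) / 2"
        using sum_squares_bound[of "\<bar>X \<omega> $ i\<bar>" "\<bar>X \<omega> $ j\<bar>"] by simp
      from mult_mono[OF elim this] show ?case
        using B_nonneg by (simp add: abs_mult mult_ac)
    qed
    show "integrable M ?S"
      by (intro integrable_mult_right integrable_divide Bochner_Integration.integrable_add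
          integrable_power_component)
  qed (intro integrable_abs integrable_prod_list)
  also have "\<dots> = (2 * B) ^ length is *
      ((expectation (\<lambda>\<omega>. \<bar>X \<omega> $ i\<bar> ^ 2) + expectation (\<lambda>\<omega>. \<bar>X \<omega> $ j\<bar> ^ 2)) / 2)"
    by (simp only: integral_mult_right_zero integral_divide_zero
        Bochner_Integration.integral_add[OF integrable_power_component integrable_power_component])
  also have "\<dots> \<le> (2 * B) ^ length is * ((B\<^sup>2 + B\<^sup>2) / 2)"
  proof (intro mult_left_mono divide_right_mono add_mono)
    show "expectation (\<lambda>\<omega>. \<bar>X \<omega> $ l\<bar> ^ 2) \<le> B\<^sup>2" for l
      by (rule order.trans[OF second_moment_le]) simp
    then show "expectation (\<lambda>\<omega>. \<bar>X \<omega> $ l\<bar> ^ 2) \<le> B\<^sup>2" for l .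
  qed (use B_nonneg in simp_all)
  finally show ?thesis
    by simp
qed

lemma product_moment_le_cube:
  "\<bar>expectation (\<lambda>\<omega>. \<Prod>i\<leftarrow>[i, j, k]. X \<omega> $ i)\<bar> \<le> 4 / 3 * B ^ 3"
proof -
  let ?S = "\<lambda>\<omega>. (\<bar>X \<omega> $ i\<bar> ^ 3 + \<bar>X \<omega> $ j\<bar> ^ 3 + \<bar>X \<omega> $ k\<bar> ^ 3) / 3"
  have "\<bar>expectation (\<lambda>\<omega>. \<Prod>i\<leftarrow>[i, j, k]. X \<omega> $ i)\<bar>
      \<le> expectation (\<lambda>\<omega>. \<bar>\<Prod>i\<leftarrow>[i, j, k]. X \<omega> $ i\<bar>)"
    by (rule integral_abs_bound)
  also have "\<dots> \<le> expectation ?S"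
  proof (rule integral_mono)
    show "\<bar>\<Prod>i\<leftarrow>[i, j, k]. X \<omega> $ i\<bar> \<le> ?S \<omega>" for \<omega>
      using am_gm_cubes[of "\<bar>X \<omega> $ i\<bar>" "\<bar>X \<omega> $ j\<bar>" "\<bar>X \<omega> $ k\<bar>"] by (simp add: abs_mult mult_ac)
    show "integrable M ?S"
      by (intro integrable_divide Bochner_Integration.integrable_add integrable_power_component)
  qed (intro integrable_abs integrable_prod_list)
  also have "\<dots> = (expectation (\<lambda>\<omega>. \<bar>X \<omega> $ i\<bar> ^ 3) + expectation (\<lambda>\<omega>. \<bar>X \<omega> $ j\<bar> ^ 3)
      + expectation (\<lambda>\<omega>. \<bar>X \<omega> $ k\<bar> ^ 3)) / 3"
    by (simp only: integral_divide_zero integrable_power_component Bochner_Integration.integral_add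
        Bochner_Integration.integrable_add)
  also have "\<dots> \<le> (4 / 3 * B ^ 3 + 4 / 3 * B ^ 3 + 4 / 3 * B ^ 3) / 3"
    by (intro divide_right_mono add_mono third_moment_le) simp
  also have "\<dots> = 4 / 3 * B ^ 3"
    by simp
  finally show ?thesis .
qed

lemma product_moment_le:
  "\<bar>expectation (\<lambda>\<omega>. \<Prod>i\<leftarrow>is. X \<omega> $ i)\<bar> \<le> moment_bound (length is) * B ^ length is"
proof -
  \<comment> \<open>Length 3 is kept apart: the general estimate would give the factor 2 there
    instead of \<open>4 / 3\<close>.\<close>
  consider "is = []" | i where "is = [i]" | i j k where "is = [i, j, k]"
    | i j js where "is = i # j # js" "length js \<noteq> 1"
  proof (cases "is")
    case (Cons i ks)
    then show ?thesis
    proof (cases ks)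
      case (Cons j js)
      show ?thesis
      proof (cases "length js = 1")
        case True
        then obtain k where "js = [k]"
          by (auto simp: length_Suc_conv)
        with Cons \<open>is = i # ks\<close> that(3) show ?thesis
          by simp
      qed (use Cons \<open>is = i # ks\<close> that(4) in simp)
    qed (use that(2) in simp)
  qed (rule that(1))
  then show ?thesis
  proof cases
    case 1
    then show ?thesis
      by (simp add: moment_bound_def prob_space)
  next
    case 2
    then show ?thesis
      by (simp add: moment_bound_def centered)
  next
    case 3
    then show ?thesis
      using product_moment_le_cube[of i j k] by (simp add: moment_bound_def numeral_3_eq_3)
  next
    case 4
    then show ?thesis
      using product_moment_le_square[of i j js]
      by (simp add: moment_bound_def power_mult_distrib power2_eq_square mult_ac)
  qed
qed

lemma exp_moment_positive: "exp_moment [] y > 0"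
  by (rule exp_moment_pos) (simp add: emeasure_space_1)

lemma all_partials_exist_cumulant: "all_partials_exist (\<lambda>y. ln (exp_moment [] y))"
  by (intro all_partials_exist_ln partials_exp_moment exp_moment_positive)

text \<open>At 0 the derivatives of the moment generating function are moments; total mass 1 and
  centering supply the normalisation.\<close>

lemma cumulant_bound:
  assumes "is \<noteq> []"
  shows "\<bar>partials is (\<lambda>y. ln (exp_moment [] y)) 0\<bar> \<le> fact (length is) * B ^ length is"
proof (rule abs_partials_ln_le[OF partials_exp_moment(2) exp_moment_positive _ _ _ B_nonneg assms])
  show "exp_moment [] 0 = 1"
    by (simp add: exp_moment_def prob_space)
  show "partials [i] (exp_moment []) 0 = 0" for i
    by (simp only: partials_exp_moment(1)) (simp add: exp_moment_def centered)
  show "\<bar>partials js (exp_moment []) 0\<bar> \<le> moment_bound (length js) * B ^ length js" for js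
    by (simp only: partials_exp_moment(1)) (simp add: exp_moment_def product_moment_le)
qed

text \<open>The general bound would leave a remainder of size \<open>B\<close> at order one and
  double the term \<open>lam t * D\<close> in the gradient estimate.\<close>

lemma first_cumulant: "partials [i] (\<lambda>y. ln (exp_moment [] y)) 0 = 0"
proof -
  have "has_partial i (\<lambda>y. ln (exp_moment [] y)) (\<lambda>y. exp_moment [i] y / exp_moment [] y)"
    by (intro has_partial_ln has_partial_exp_moment exp_moment_positive)
  from partials_singleton_eq[OF this] show ?thesis
    by (simp add: exp_moment_def centered)
qed

end

section \<open>The Gaussian mixture\<close>

lemma sig_pos: "t > 0 \<Longrightarrow> sig t > 0"
  by (simp add: sig_def)

lemma lam_pos: "lam t > 0"
  by (simp add: lam_def)

text \<open>Up to a factor free of \<open>x\<close>, passing from \<open>y0\<close> to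
  \<open>y\<close> multiplies the Gaussian weight by an exponential linear in \<open>x\<close>, so
  the ratio of densities is a moment generating function of the posterior law. The decomposition
  depends on \<open>y0\<close>, and \<open>u\<close> is controlled at that point.\<close>

lemma log_density_decomposition:
  fixes \<mu> :: "(real ^ 'n) measure" and y0 :: "real ^ 'n"
  assumes "prob_space \<mu>" and sets_\<mu> [measurable_cong]: "sets \<mu> = sets borel"
    and bounded: "AE x in \<mu>. \<forall>i. \<bar>x $ i\<bar> \<le> D" and "t > 0"
  obtains k b u where
    "(\<lambda>y. ln (q_density \<mu> t y)) = (\<lambda>y. quadratic_partials k b ((sig t)\<^sup>2) [] y + u y)"
    and "all_partials_exist u" and "\<And>i. \<bar>b $ i\<bar> \<le> lam t * D / (sig t)\<^sup>2"
    and "\<And>i. partials [i] u y0 = 0"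
    and "\<And>is. is \<noteq> [] \<Longrightarrow> \<bar>partials is u y0\<bar> \<le> fact (length is) * (lam t * D / (sig t)\<^sup>2) ^ length is"
proof -
  interpret \<mu>: prob_space \<mu>
    by fact
  define s where "s = (sig t)\<^sup>2"
  define c where "c = lam t / s"
  have s: "s > 0" and c: "c > 0"
    using sig_pos[OF \<open>t > 0\<close>] lam_pos by (simp_all add: s_def c_def)
  define w where "w = (\<lambda>y x :: real ^ 'n. 1 / (sqrt (2 * pi) * sig t) ^ CARD('n)
      * exp (- (norm (y - lam t *\<^sub>R x))\<^sup>2 / (2 * s)))"
  define q where "q = q_density \<mu> t"
  have q_eq: "q y = (\<integral>x. w y x \<partial>\<mu>)" for y
    by (simp add: q_def q_density_def w_def s_def)
  have w_pos: "w y x > 0" for y x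
    using sig_pos[OF \<open>t > 0\<close>] by (simp add: w_def)
  have [measurable]: "w y \<in> borel_measurable \<mu>" for y
    unfolding w_def by measurable
  have int_w: "integrable \<mu> (w y)" for y
  proof (rule \<mu>.integrable_const_bound)
    show "AE x in \<mu>. norm (w y x) \<le> 1 / (sqrt (2 * pi) * sig t) ^ CARD('n)"
    proof (rule AE_I2)
      fix x
      have "w y x \<le> 1 / (sqrt (2 * pi) * sig t) ^ CARD('n) * 1"
        unfolding w_def using sig_pos[OF \<open>t > 0\<close>] s by (intro mult_left_mono) auto
      then show "norm (w y x) \<le> 1 / (sqrt (2 * pi) * sig t) ^ CARD('n)"
        using w_pos[of y x] by simp
    qed
  qed simp
  have q_pos: "q y > 0" for y
  proof -
    have "q y \<noteq> 0"
    proof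
      assume "q y = 0"
      then have "AE x in \<mu>. w y x = 0"
        using int_w[of y] w_pos[of y]
        by (subst (asm) q_eq) (simp add: integral_nonneg_eq_0_iff_AE less_imp_le)
      then have "AE x in \<mu>. False"
        using w_pos[of y] by (simp add: less_imp_neq[symmetric])
      then show False
        by (simp add: \<mu>.AE_False)
    qed
    moreover have "q y \<ge> 0"
      using w_pos[of y] by (simp add: q_eq less_imp_le)
    ultimately show ?thesis
      by simp
  qed
  \<comment> \<open>The posterior law of \<open>x\<close> given \<open>y0\<close>, with
    \<open>q y0\<close> as normalising constant.\<close>
  define \<pi> where "\<pi> = density \<mu> (\<lambda>x. ennreal (w y0 x / q y0))"
  have weight_nonneg: "w y0 x / q y0 \<ge> 0" for x
    using w_pos[of y0 x] q_pos[of y0] by simp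
  have integral_\<pi>: "(\<integral>x. f x \<partial>\<pi>) = (\<integral>x. w y0 x / q y0 * f x \<partial>\<mu>)"
    if "f \<in> borel_measurable borel" for f :: "real ^ 'n \<Rightarrow> real"
    unfolding \<pi>_def using that weight_nonneg by (intro integral_real_density) auto
  have sets_\<pi> [measurable_cong]: "sets \<pi> = sets borel"
    by (simp add: \<pi>_def sets_\<mu>)
  interpret \<pi>: prob_space \<pi>
  proof
    have "emeasure \<pi> (space \<pi>) = (\<integral>\<^sup>+x. ennreal (w y0 x / q y0) \<partial>\<mu>)"
      by (simp add: \<pi>_def emeasure_density cong: nn_integral_cong)
    also have "\<dots> = ennreal (\<integral>x. w y0 x / q y0 \<partial>\<mu>)"
      using weight_nonneg int_w by (intro nn_integral_eq_integral) auto
    also have "(\<integral>x. w y0 x / q y0 \<partial>\<mu>) = 1"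
      using q_pos[of y0] by (simp add: q_eq)
    finally show "emeasure \<pi> (space \<pi>) = 1"
      by simp
  qed
  have bounded_\<pi>: "AE x in \<pi>. \<forall>i. \<bar>x $ i\<bar> \<le> D"
    unfolding \<pi>_def by (subst AE_density) (use bounded in \<open>auto elim: eventually_mono\<close>)
  have int_x: "integrable \<pi> (\<lambda>x. x $ i)" for i
    using bounded_\<pi> by (intro \<pi>.integrable_const_bound[where B = D]) (auto elim: eventually_mono)
  define m where "m = (\<chi> i. \<integral>x. x $ i \<partial>\<pi>)"
  \<comment> \<open>\<open>c\<close> is the coefficient of \<open>x \<bullet> (y - y0)\<close> in
    the exponent. The uncentered vector is then \<open>c *\<^sub>R x\<close>, with components
    bounded by \<open>c * D\<close>, which is \<open>B\<close>.\<close>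
  define X where "X = (\<lambda>x. c *\<^sub>R (x - m))"
  define B where "B = lam t * D / s"
  interpret centered_vector \<pi> X "c *\<^sub>R m" B
  proof
    show "X \<in> borel_measurable \<pi>"
      unfolding X_def by measurable
    show "(\<integral>x. X x $ i \<partial>\<pi>) = 0" for i
      using int_x by (simp add: X_def m_def \<pi>.prob_space)
    show "AE x in \<pi>. \<forall>i. \<bar>(c *\<^sub>R m) $ i + X x $ i\<bar> \<le> B"
      using bounded_\<pi>
    proof eventually_elim
      case (elim x)
      have "\<bar>c * x $ i\<bar> \<le> B" for i
      proof -
        have "\<bar>c * x $ i\<bar> = c * \<bar>x $ i\<bar>"
          using c by (simp add: abs_mult)
        also have "\<dots> \<le> c * D"
          using elim c by (intro mult_left_mono) auto
        finally show ?thesis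
          by (simp add: B_def c_def)
      qed
      then show ?case
        by (simp add: X_def algebra_simps)
    qed
  qed
  define u where "u = (\<lambda>y. ln (exp_moment [] (y - y0)))"
  \<comment> \<open>This value makes the quadratic equal \<open>ln (q y0)\<close> at
    \<open>y0\<close>, where \<open>u\<close> vanishes.\<close>
  define k where "k = ln (q y0) + (norm y0)\<^sup>2 / (2 * s) - (c *\<^sub>R m) \<bullet> y0"
  have "ln (q y) = quadratic_partials k (c *\<^sub>R m) s [] y + u y" for y
  proof -
    \<comment> \<open>Collects the part of the change of exponent that is free of
      \<open>x\<close>.\<close>
    define e where "e = ((norm y)\<^sup>2 - (norm y0)\<^sup>2) / (2 * s) - (c *\<^sub>R m) \<bullet> (y - y0)"
    have "w y0 x * exp (X x \<bullet> (y - y0)) = w y x * exp e" for x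
    proof -
      have "(norm (y - lam t *\<^sub>R x))\<^sup>2 - (norm (y0 - lam t *\<^sub>R x))\<^sup>2
          = (norm y)\<^sup>2 - (norm y0)\<^sup>2 - 2 * lam t * (x \<bullet> (y - y0))"
        unfolding power2_norm_eq_inner
        by (simp add: inner_diff_left inner_diff_right inner_commute algebra_simps)
      then have "((norm (y - lam t *\<^sub>R x))\<^sup>2 - (norm (y0 - lam t *\<^sub>R x))\<^sup>2) / (2 * s)
          = ((norm y)\<^sup>2 - (norm y0)\<^sup>2) / (2 * s) - c * (x \<bullet> (y - y0))"
        using s by (simp add: c_def diff_divide_distrib)
      then have "- (norm (y0 - lam t *\<^sub>R x))\<^sup>2 / (2 * s) + X x \<bullet> (y - y0)
          = - (norm (y - lam t *\<^sub>R x))\<^sup>2 / (2 * s) + e"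
        by (simp add: X_def e_def inner_diff_left right_diff_distrib diff_divide_distrib)
      then show ?thesis
        by (simp add: w_def mult.assoc flip: exp_add)
    qed
    then have tilt: "w y0 x / q y0 * exp (X x \<bullet> (y - y0)) = w y x * (exp e / q y0)" for x
      by simp
    have "exp_moment [] (y - y0) = (\<integral>x. exp (X x \<bullet> (y - y0)) \<partial>\<pi>)"
      by (simp add: exp_moment_def)
    also have "\<dots> = (\<integral>x. w y0 x / q y0 * exp (X x \<bullet> (y - y0)) \<partial>\<mu>)"
      unfolding X_def by (rule integral_\<pi>) measurable
    also have "\<dots> = (\<integral>x. w y x * (exp e / q y0) \<partial>\<mu>)"
      unfolding tilt ..
    also have "\<dots> = q y * (exp e / q y0)"
      by (simp add: q_eq)
    finally have "u y = ln (q y) + e - ln (q y0)"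
      using q_pos[of y] q_pos[of y0] by (simp add: u_def ln_mult ln_div)
    then show ?thesis
      by (simp add: k_def e_def inner_diff_right diff_divide_distrib)
  qed
  then have eq: "(\<lambda>y. ln (q_density \<mu> t y)) =
      (\<lambda>y. quadratic_partials k (c *\<^sub>R m) ((sig t)\<^sup>2) [] y + u y)"
    by (simp only: q_def s_def)
  have partials_u: "partials is u y0 = partials is (\<lambda>y. ln (exp_moment [] y)) 0" for "is"
    unfolding u_def using partials_translate(1)[OF all_partials_exist_cumulant, of "is" y0 y0] by simp
  show thesis
  proof (rule that[OF eq])
    show "all_partials_exist u"
      unfolding u_def by (rule partials_translate(2)[OF all_partials_exist_cumulant])
    show "\<bar>(c *\<^sub>R m) $ i\<bar> \<le> lam t * D / (sig t)\<^sup>2" for i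
      using mean_le[of i] unfolding B_def s_def .
    show "partials [i] u y0 = 0" for i
      unfolding partials_u by (rule first_cumulant)
    show "\<bar>partials is u y0\<bar> \<le> fact (length is) * (lam t * D / (sig t)\<^sup>2) ^ length is"
      if "is \<noteq> []" for "is"
      using cumulant_bound[OF that] unfolding partials_u B_def s_def .
  qed
qed

section \<open>Compact support and the final estimates\<close>

text \<open>Compactness bounds the image of \<open>infnorm\<close> above, which makes the
  real-valued \<open>SUP\<close> a genuine upper bound.\<close>

lemma AE_component_le_of_compact:
  fixes \<mu> :: "(real ^ 'n) measure"
  assumes "compact K" "AE x in \<mu>. x \<in> K"
  shows "AE x in \<mu>. \<forall>i. \<bar>x $ i\<bar> \<le> 1 + (SUP x\<in>K. infnorm x)"
proof -
  have "bdd_above (infnorm ` K)"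
    using assms(1) by (intro bounded_imp_bdd_above compact_imp_bounded compact_continuous_image
        continuous_intros)
  from assms(2) show ?thesis
  proof eventually_elim
    case (elim x)
    have "infnorm x \<le> (SUP x\<in>K. infnorm x)"
      by (rule cSUP_upper[OF elim \<open>bdd_above (infnorm ` K)\<close>])
    then have "\<bar>x $ i\<bar> \<le> 1 + (SUP x\<in>K. infnorm x)" for i
      using component_le_infnorm_cart[of x i] by linarith
    then show ?case
      by blast
  qed
qed

theorem lemmaB3:
  fixes \<mu> :: "(real ^ 'n) measure" and K :: "(real ^ 'n) set" and D :: real
  assumes "prob_space \<mu>" and "sets \<mu> = sets borel"
    and "compact K" and "AE x in \<mu>. x \<in> K"
    and "D = 1 + (SUP x\<in>K. infnorm x)"
  shows "(\<forall>t>0. \<forall>is. partials_exist is (\<lambda>y. ln (q_density \<mu> t y)))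
    \<and> (\<forall>p\<ge>3. \<forall>y. \<forall>t>0. deriv_tensor_norm p (\<lambda>y. ln (q_density \<mu> t y)) y
          \<le> (4 * fact p) * ((lam t ^ p * D ^ p) / sig t ^ (2 * p)))
    \<and> (\<forall>i y. \<forall>t>0. \<bar>partials [i] (\<lambda>y. ln (q_density \<mu> t y)) y\<bar>
          \<le> (\<bar>y $ i\<bar> + lam t * D) / (sig t)\<^sup>2)
    \<and> (\<forall>i j y. \<forall>t>0. \<bar>partials [i, j] (\<lambda>y. ln (q_density \<mu> t y)) y\<bar>
          \<le> (if i = j then 1 else 0) / (sig t)\<^sup>2 + 2 * ((lam t)\<^sup>2 * D\<^sup>2) / sig t ^ 4)"
proof -
  have bounded: "AE x in \<mu>. \<forall>i. \<bar>x $ i\<bar> \<le> D"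
    unfolding assms(5) by (rule AE_component_le_of_compact[OF assms(3,4)])
  have D_nonneg: "0 \<le> D"
  proof -
    interpret prob_space \<mu>
      by fact
    \<comment> \<open>A statement free of \<open>x\<close> that holds almost everywhere on a
      probability space holds outright.\<close>
    have "AE x in \<mu>. 0 \<le> D"
      using bounded by eventually_elim (meson abs_ge_zero order.trans)
    then show ?thesis
      by simp
  qed
  note decompose = log_density_decomposition[OF assms(1,2) bounded]
  have exist: "partials_exist is (\<lambda>y. ln (q_density \<mu> t y))" if "t > 0" for t "is"
  proof -
    \<comment> \<open>Existence concerns all points at once, so one decomposition, based at 0,
      suffices.\<close>
    obtain k b u where eq: "(\<lambda>y. ln (q_density \<mu> t y)) =
          (\<lambda>y. quadratic_partials k b ((sig t)\<^sup>2) [] y + u y)"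
        and u: "all_partials_exist u"
      by (rule decompose[OF \<open>t > 0\<close>, of 0]) (rule that)
    have "all_partials_exist (\<lambda>y. ln (q_density \<mu> t y))"
      unfolding eq by (intro all_partials_exist_add partials_quadratic(2) u)
    then show ?thesis
      by (simp add: all_partials_exist_def)
  qed
  \<comment> \<open>The decomposition is based at \<open>y\<close> itself. Its constant term
    disappears under differentiation, hence the 0 in \<open>quadratic_partials\<close>; the exact
    vanishing of \<open>r\<close> at order one is kept for the gradient.\<close>
  have bound: "\<exists>b r. (\<forall>i. \<bar>b $ i\<bar> \<le> lam t * D / (sig t)\<^sup>2)
      \<and> partials is (\<lambda>y. ln (q_density \<mu> t y)) y = quadratic_partials 0 b ((sig t)\<^sup>2) is y + r
      \<and> \<bar>r\<bar> \<le> fact (length is) * (lam t * D / (sig t)\<^sup>2) ^ length is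
      \<and> (length is = 1 \<longrightarrow> r = 0)"
    if "t > 0" "is \<noteq> []" for t "is" and y :: "real ^ 'n"
  proof -
    obtain k b u where eq: "(\<lambda>y. ln (q_density \<mu> t y)) =
          (\<lambda>y. quadratic_partials k b ((sig t)\<^sup>2) [] y + u y)"
        and u: "all_partials_exist u" "\<And>i. \<bar>b $ i\<bar> \<le> lam t * D / (sig t)\<^sup>2"
          "\<And>i. partials [i] u y = 0"
          "\<And>is. is \<noteq> [] \<Longrightarrow>
            \<bar>partials is u y\<bar> \<le> fact (length is) * (lam t * D / (sig t)\<^sup>2) ^ length is"
      by (rule decompose[OF \<open>t > 0\<close>, of y]) (rule that)
    have quadratic: "quadratic_partials k b ((sig t)\<^sup>2) is y = quadratic_partials 0 b ((sig t)\<^sup>2) is y"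
    proof (cases "is")
      case (Cons i js)
      then show ?thesis
        by (cases js rule: remdups_adj.cases) simp_all
    qed (use \<open>is \<noteq> []\<close> in simp)
    have sum: "partials is (\<lambda>y. ln (q_density \<mu> t y)) y =
        quadratic_partials 0 b ((sig t)\<^sup>2) is y + partials is u y"
      unfolding eq partials_add[OF partials_quadratic(2) u(1)] partials_quadratic(1) quadratic ..
    have "partials is u y = 0" if "length is = 1"
    proof -
      from that obtain i where "is = [i]"
        by (auto simp: length_Suc_conv)
      then show ?thesis
        by (simp only: u(3))
    qed
    with sum u(2) u(4)[OF \<open>is \<noteq> []\<close>] show ?thesis
      by blast
  qed
  have third: "deriv_tensor_norm p (\<lambda>y. ln (q_density \<mu> t y)) y
      \<le> (4 * fact p) * ((lam t ^ p * D ^ p) / sig t ^ (2 * p))"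
    if "p \<ge> 3" "t > 0" for p t y
    unfolding deriv_tensor_norm_def
  proof (rule Max.boundedI)
    have "finite {is :: 'n list. set is \<subseteq> UNIV \<and> length is = p}"
      by (rule finite_lists_length_eq) simp
    then show "finite ((\<lambda>is. \<bar>partials is (\<lambda>y. ln (q_density \<mu> t y)) y\<bar>) ` {is :: 'n list. length is = p})"
      by simp
    have "replicate p undefined \<in> {is :: 'n list. length is = p}"
      by simp
    then show "(\<lambda>is. \<bar>partials is (\<lambda>y. ln (q_density \<mu> t y)) y\<bar>) ` {is :: 'n list. length is = p} \<noteq> {}"
      by blast
    fix x
    assume "x \<in> (\<lambda>is. \<bar>partials is (\<lambda>y. ln (q_density \<mu> t y)) y\<bar>) ` {is :: 'n list. length is = p}"
    then obtain "is" :: "'n list"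
      where x: "x = \<bar>partials is (\<lambda>y. ln (q_density \<mu> t y)) y\<bar>" and p: "length is = p"
      by blast
    then have "is \<noteq> []"
      using \<open>p \<ge> 3\<close> by auto
    then obtain b r where r: "partials is (\<lambda>y. ln (q_density \<mu> t y)) y =
          quadratic_partials 0 b ((sig t)\<^sup>2) is y + r"
        "\<bar>r\<bar> \<le> fact (length is) * (lam t * D / (sig t)\<^sup>2) ^ length is"
      using bound[OF \<open>t > 0\<close>, of "is" y] by blast
    have "quadratic_partials 0 b ((sig t)\<^sup>2) is y = 0"
      using p \<open>p \<ge> 3\<close> by (simp add: quadratic_partials_eq_0)
    with r have "x \<le> fact p * (lam t * D / (sig t)\<^sup>2) ^ p"
      unfolding x p by simp
    also have "\<dots> = fact p * ((lam t ^ p * D ^ p) / sig t ^ (2 * p))"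
      unfolding power_divide power_mult_distrib power_mult ..
    \<comment> \<open>The cumulant bound comes with \<open>fact p\<close>; nonnegativity of the
      quotient allows the larger constant.\<close>
    also have "\<dots> \<le> (4 * fact p) * ((lam t ^ p * D ^ p) / sig t ^ (2 * p))"
    proof (rule mult_right_mono)
      show "0 \<le> lam t ^ p * D ^ p / sig t ^ (2 * p)"
        using D_nonneg less_imp_le[OF lam_pos[of t]] less_imp_le[OF sig_pos[OF \<open>t > 0\<close>]] by simp
    qed simp
    finally show "x \<le> (4 * fact p) * ((lam t ^ p * D ^ p) / sig t ^ (2 * p))" .
  qed
  have first: "\<bar>partials [i] (\<lambda>y. ln (q_density \<mu> t y)) y\<bar> \<le> (\<bar>y $ i\<bar> + lam t * D) / (sig t)\<^sup>2"
    if "t > 0" for i t and y :: "real ^ 'n"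
  proof -
    obtain b where b: "\<bar>b $ i\<bar> \<le> lam t * D / (sig t)\<^sup>2"
        "partials [i] (\<lambda>y. ln (q_density \<mu> t y)) y = b $ i - y $ i / (sig t)\<^sup>2"
      using bound[OF \<open>t > 0\<close>, of "[i]" y] by (auto simp del: partials.simps)
    have "\<bar>b $ i - y $ i / (sig t)\<^sup>2\<bar> \<le> \<bar>b $ i\<bar> + \<bar>y $ i / (sig t)\<^sup>2\<bar>"
      by (rule abs_triangle_ineq4)
    also have "\<dots> \<le> lam t * D / (sig t)\<^sup>2 + \<bar>y $ i\<bar> / (sig t)\<^sup>2"
      using b(1) by simp
    finally show ?thesis
      by (simp add: b(2) add_divide_distrib del: partials.simps)
  qed
  have second: "\<bar>partials [i, j] (\<lambda>y. ln (q_density \<mu> t y)) y\<bar>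
      \<le> (if i = j then 1 else 0) / (sig t)\<^sup>2 + 2 * ((lam t)\<^sup>2 * D\<^sup>2) / sig t ^ 4"
    if "t > 0" for i j t and y :: "real ^ 'n"
  proof -
    obtain b :: "real ^ 'n" and r where r: "partials [i, j] (\<lambda>y. ln (q_density \<mu> t y)) y =
          quadratic_partials 0 b ((sig t)\<^sup>2) [i, j] y + r"
        "\<bar>r\<bar> \<le> fact (length [i, j]) * (lam t * D / (sig t)\<^sup>2) ^ length [i, j]"
      using bound[OF \<open>t > 0\<close>, of "[i, j]" y] by blast
    have "(lam t * D / (sig t)\<^sup>2)\<^sup>2 = (lam t)\<^sup>2 * D\<^sup>2 / sig t ^ 4"
      by (simp add: power_divide power_mult_distrib flip: power_mult)
    \<comment> \<open>The constant 2 of the Hessian estimate is the factorial of the order.\<close>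
    then have "fact (length [i, j]) * (lam t * D / (sig t)\<^sup>2) ^ length [i, j] =
        2 * ((lam t)\<^sup>2 * D\<^sup>2) / sig t ^ 4"
      by (simp add: numeral_2_eq_2)
    moreover have "\<bar>quadratic_partials 0 b ((sig t)\<^sup>2) [i, j] y\<bar> = (if i = j then 1 else 0) / (sig t)\<^sup>2"
      by simp
    ultimately show ?thesis
      using r abs_triangle_ineq[of "quadratic_partials 0 b ((sig t)\<^sup>2) [i, j] y" r] by linarith
  qed
  show ?thesis
    by (intro conjI allI impI exist third first second)
qed

end
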